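(* There exists an absolute constant $C_0$ such that the following holds. Let $f\in H^\infty$. For every $\varepsilon>0$ and every compact subset $K$ of $\mathbb D$ there is a number $N(f,\varepsilon,K)$ such that for every integer $N\ge N(f,\varepsilon,K)$ there exists $h\in\mathcal{SF}_N$ with $$\|f-h\|_{L^\infty(K)}\le\varepsilon,$$ $$|h(z)|\le \frac1{1-|z|}+C_0\|f\|_{H^\infty}\log\frac e{1-|z|},\qquad z\in\mathbb D.$$
   Context: $\mathbb D$ is the open unit disk of $\mathbb C$ and $\mathbb T$ is the unit circle. $H^\infty$ is the space of bounded analytic functions in $\mathbb D$ with the supremum norm. For $N\ge1$, $\mathcal{SF}_N=\bigl\{\sum_{0\le j<N}\frac1{z-z_{j}}: z_{j}\in\mathbb T,\ 0\le j<N\bigr\}$ (the points $z_j$ need not be distinct). *)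

theory Defs
  imports "HOL-Analysis.Analysis"
begin

(* Inserting 0 changes nothing on a nonempty set and gives the empty set norm 0.
   The value is meaningful only for functions bounded on S. *)
definition sup_norm_on :: "complex set \<Rightarrow> (complex \<Rightarrow> complex) \<Rightarrow> real" where
  "sup_norm_on S f = Sup (insert 0 ((\<lambda>z. norm (f z)) ` S))"

(* Elements are total functions; their values outside the unit disc are irrelevant. *)
definition H_infinity :: "(complex \<Rightarrow> complex) set" where
  "H_infinity = {f. f holomorphic_on ball 0 1 \<and> bounded (f ` ball 0 1)}"

abbreviation H_infinity_norm :: "(complex \<Rightarrow> complex) \<Rightarrow> real" where
  "H_infinity_norm f \<equiv> sup_norm_on (ball 0 1) f"

(* Simple partial fractions with N poles on the unit circle, repetitions allowed. *)
definition SF :: "nat \<Rightarrow> (complex \<Rightarrow> complex) set" where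
  "SF N = {h. \<exists>p :: nat \<Rightarrow> complex. (\<forall>j<N. p j \<in> sphere 0 1) \<and>
                h = (\<lambda>z. \<Sum>j<N. 1 / (z - p j))}"

end

theory Submission
  imports Defs "HOL-Complex_Analysis.Complex_Analysis"
    "HOL-Computational_Algebra.Fundamental_Theorem_Algebra"
begin

text \<open>
  Write $P^*$ for the conjugate reciprocal of a polynomial $P$ without zeros in the closed disc.
  For $m \ge 1$ all zeros of $Q = P + z^m P^*$ lie on the unit circle, since
  $|P^*| \le |P|$ in the disc and $Q$ is its own conjugate reciprocal. Hence
  $h = Q'/Q$ is a simple partial fraction with $m + \deg P$ poles, and
  $h = P'/P + B'/(1+B)$ with $B = z^m P^*/P$ in the disc. The Schwarz--Pick inequality together
  with $|B(z)| \le |z|$ gives $|B'/(1+B)| \le (1+|B|)/(1-|z|^2) \le 1/(1-|z|)$, and on compact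
  sets this term tends to $0$ as $m \to \infty$. Finally $P$ is a Taylor polynomial of $\exp F$
  with $F'(z) = f(rz)$, $r < 1$ close to $1$, so that $P'/P$ is uniformly close to $f(rz)$ on the
  closed disc. The first summand is thus bounded by $2\|f\|$, without the logarithm.
\<close>

section \<open>Schwarz-Pick inequality and logarithmic derivatives of self-maps of the disc\<close>

text \<open>Composing with disc automorphisms that send 0 to \<open>a\<close> and \<open>f a\<close>
  to 0 gives a self-map \<open>g\<close> fixing 0. The Schwarz lemma bounds \<open>deriv g 0\<close>
  by 1, and the chain rule translates this back to \<open>a\<close>.\<close>

lemma Schwarz_Pick_deriv:
  assumes holf: "f holomorphic_on ball 0 1"
    and f1: "\<And>z. norm z < 1 \<Longrightarrow> norm (f z) < 1"
    and a: "norm a < 1"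
  shows "norm (deriv f a) * (1 - (norm a)\<^sup>2) \<le> 1 - (norm (f a))\<^sup>2"
proof -
  define b where "b = f a"
  have b: "norm b < 1" using f1 a by (simp add: b_def)
  define g where "g = (\<lambda>z. Moebius_function 0 b (f (Moebius_function 0 (-a) z)))"
  have Ma: "Moebius_function 0 (-a) ` ball 0 1 \<subseteq> ball 0 1"
    using Moebius_function_norm_lt_1 a by auto
  have "(Moebius_function 0 b \<circ> (f \<circ> Moebius_function 0 (-a))) holomorphic_on ball 0 1"
    by (intro holomorphic_on_compose_gen[where t = "ball 0 1"] holf Moebius_function_holomorphic)
       (use a b Ma f1 in \<open>auto simp: Moebius_function_norm_lt_1\<close>)
  then have holg: "g holomorphic_on ball 0 1" by (simp add: g_def o_def)
  have M0: "Moebius_function 0 (-a) 0 = a" by (simp add: Moebius_function_of_zero)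
  have g0: "g 0 = 0" by (simp add: g_def M0 b_def Moebius_function_eq_zero)
  have g1: "norm (g z) < 1" if "norm z < 1" for z
    unfolding g_def using that a by (intro Moebius_function_norm_lt_1 b f1) simp_all
  have nz: "1 - complex_of_real ((norm b)\<^sup>2) \<noteq> 0"
  proof -
    have "(norm b)\<^sup>2 < 1" using b by (simp add: power_less_one_iff abs_square_less_1)
    then show ?thesis by (metis eq_iff_diff_eq_0 less_irrefl of_real_1 of_real_eq_iff)
  qed
  have d1: "(Moebius_function 0 (-a) has_field_derivative (1 - of_real ((norm a)\<^sup>2))) (at 0)"
    unfolding Moebius_function_def
    by (rule derivative_eq_intros refl | simp)+ (simp add: complex_norm_square[symmetric] mult.commute flip: of_real_power)
  have d2: "(f has_field_derivative deriv f a) (at (Moebius_function 0 (-a) 0))"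
    using holf a M0 by (auto intro: holomorphic_derivI[where S = "ball 0 1"])
  have bb: "cnj b * b = of_real ((norm b)\<^sup>2)" 
    by (subst complex_norm_square) (rule mult.commute)
  have d3: "(Moebius_function 0 b has_field_derivative 1 / (1 - of_real ((norm b)\<^sup>2)))
              (at (f (Moebius_function 0 (-a) 0)))"
    unfolding M0 b_def[symmetric] unfolding Moebius_function_def
    by (rule derivative_eq_intros refl | use nz bb in \<open>simp\<close>)+
  have "(g has_field_derivative (1 / (1 - of_real ((norm b)\<^sup>2)) * (deriv f a * (1 - of_real ((norm a)\<^sup>2))))) (at 0)"
    unfolding g_def
    by (rule DERIV_chain2[where f = "Moebius_function 0 b", OF d3 DERIV_chain2[where f = f, OF d2 d1]])
  then have "deriv g 0 = 1 / (1 - of_real ((norm b)\<^sup>2)) * (deriv f a * (1 - of_real ((norm a)\<^sup>2)))"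
    by (rule DERIV_imp_deriv)
  also have "\<dots> = (deriv f a * of_real (1 - (norm a)\<^sup>2)) / of_real (1 - (norm b)\<^sup>2)"
    by simp
  finally have "norm (deriv g 0) = norm (deriv f a) * \<bar>1 - (norm a)\<^sup>2\<bar> / \<bar>1 - (norm b)\<^sup>2\<bar>"
    by (simp only: norm_divide norm_mult norm_of_real)
  moreover have "norm (deriv g 0) \<le> 1"
    using Schwarz_Lemma(2)[OF holg g0 g1, of 0] by simp
  moreover have "(norm a)\<^sup>2 < 1" "(norm b)\<^sup>2 < 1"
    using a b by (simp_all add: abs_square_less_1)
  ultimately show ?thesis by (simp add: b_def divide_le_eq)
qed

text \<open>In the Schwarz-Pick inequality both sides factor as differences of squares. Since
  \<open>norm (B z) \<le> norm z\<close>, the factor \<open>1 + norm z\<close> cancels, and the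
  remaining \<open>1 - norm (B z)\<close> is at most \<open>norm (1 + B z)\<close>. This yields the
  coefficient exactly 1 of \<open>1 / (1 - norm z)\<close> in the theorem.\<close>

lemma self_map_logderiv_bound:
  assumes holB: "B holomorphic_on ball 0 1" and B1: "\<And>z. norm z < 1 \<Longrightarrow> norm (B z) < 1"
    and Bz: "norm (B z) \<le> norm z" and z: "norm z < 1"
  shows "norm (deriv B z / (1 + B z)) \<le> 1 / (1 - norm z)"
proof -
  let ?b = "norm (B z)"
  have b: "?b < 1" using B1 z .
  have low: "1 - ?b \<le> norm (1 + B z)"
    by (metis add.commute diff_add_cancel norm_diff_ineq norm_one)
  have "norm (deriv B z) * (1 - norm z) * (1 + norm z) \<le> (1 - ?b) * (1 + ?b)"
    using Schwarz_Pick_deriv[OF holB B1 z] by (simp add: algebra_simps power2_eq_square)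
  also have "\<dots> \<le> (1 - ?b) * (1 + norm z)"
    using b Bz by (intro mult_left_mono) auto
  finally have "norm (deriv B z) * (1 - norm z) \<le> 1 - ?b"
    by (rule mult_right_le_imp_le) (use norm_ge_zero[of z] in linarith)
  also have "\<dots> \<le> norm (1 + B z)" by (rule low)
  finally have "norm (deriv B z) \<le> norm (1 + B z) / (1 - norm z)"
    using z by (simp add: pos_le_divide_eq)
  moreover have "norm (1 + B z) > 0" using b low by linarith
  ultimately show ?thesis
    unfolding norm_divide by (intro mult_imp_div_pos_le) auto
qed

section \<open>Conjugate reciprocals and polynomials with all zeros on the unit circle\<close>

text \<open>\<open>reflect_poly\<close> reverses the coefficients up to the degree, so the degree
  can drop when the constant coefficient of \<open>p\<close> vanishes.\<close>

definition conj_reciprocal :: "complex poly \<Rightarrow> complex poly" where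
  "conj_reciprocal p = reflect_poly (map_poly cnj p)"

lemma poly_conj_reciprocal:
  assumes "z \<noteq> 0"
  shows "poly (conj_reciprocal p) z = z ^ degree p * cnj (poly p (cnj (inverse z)))"
proof -
  have "degree (map_poly cnj p) = degree p" by (rule degree_map_poly) auto
  with assms show ?thesis by (simp add: conj_reciprocal_def poly_reflect_poly_nz)
qed

text \<open>On the unit circle \<open>cnj (inverse w) = w\<close>, so numerator and denominator have
  equal modulus there; the maximum modulus principle carries the bound inside.\<close>

lemma conj_reciprocal_le:
  assumes nz: "\<And>z. norm z \<le> 1 \<Longrightarrow> poly p z \<noteq> 0" and z: "norm z \<le> 1"
  shows "norm (poly (conj_reciprocal p) z / poly p z) \<le> 1"
proof (rule maximum_modulus_frontier
    [where S = "cball 0 1" and f = "\<lambda>z. poly (conj_reciprocal p) z / poly p z"])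
  show "(\<lambda>z. poly (conj_reciprocal p) z / poly p z) holomorphic_on interior (cball 0 1)"
    by (intro holomorphic_intros) (use nz in auto)
  show "continuous_on (closure (cball 0 1)) (\<lambda>z. poly (conj_reciprocal p) z / poly p z)"
    by (intro continuous_intros) (use nz in auto)
  fix w :: complex assume "w \<in> frontier (cball 0 1)"
  then have w: "norm w = 1" by auto
  then have w0: "w \<noteq> 0" by auto
  moreover have "w * cnj w = 1" by (simp add: complex_norm_square[symmetric] w)
  ultimately have "cnj (inverse w) = w" by (simp add: field_simps)
  then show "norm (poly (conj_reciprocal p) w / poly p w) \<le> 1"
    using w w0 nz[of w] by (simp add: poly_conj_reciprocal norm_divide norm_mult norm_power)
qed (use z in auto)

text \<open>This is the polynomial \<open>Q\<close> of the overview.\<close>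

definition self_reciprocal :: "nat \<Rightarrow> complex poly \<Rightarrow> complex poly" where
  "self_reciprocal m p = p + monom 1 m * conj_reciprocal p"

text \<open>The conjugate of \<open>poly p 0\<close> is the coefficient of order
  \<open>degree p\<close> in the reciprocal, so that degree does not drop, and \<open>m > 0\<close>
  lets the shifted term dominate \<open>p\<close>. The exact degree matters because it is the number
  of poles.\<close>

lemma degree_self_reciprocal:
  assumes "poly p 0 \<noteq> 0" "m > 0"
  shows "degree (self_reciprocal m p) = m + degree p"
proof -
  have p0: "coeff (map_poly cnj p) 0 \<noteq> 0" using assms by (simp add: coeff_map_poly poly_0_coeff_0)
  have "degree (map_poly cnj p) = degree p" by (rule degree_map_poly) auto
  then have "degree (conj_reciprocal p) = degree p"
    using p0 by (simp add: conj_reciprocal_def)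
  moreover have "conj_reciprocal p \<noteq> 0" using p0 by (auto simp: conj_reciprocal_def)
  ultimately have "degree (monom 1 m * conj_reciprocal p) = m + degree p"
    by (simp add: degree_mult_eq degree_monom_eq monom_eq_0_iff)
  then show ?thesis
    using assms unfolding self_reciprocal_def by (subst degree_add_eq_right) auto
qed

lemma norm_power_mult_reciprocal_le:
  assumes nz: "\<And>z. norm z \<le> 1 \<Longrightarrow> poly p z \<noteq> 0" and m: "m > 0" and z: "norm z < 1"
  shows "norm (z ^ m * (poly (conj_reciprocal p) z / poly p z)) \<le> norm z"
proof -
  have "norm z ^ m * norm (poly (conj_reciprocal p) z / poly p z) \<le> norm z ^ 1 * 1"
    using conj_reciprocal_le[OF nz, of z] z m
    by (intro mult_mono power_decreasing) auto
  then show ?thesis by (simp only: norm_mult norm_power power_one_right mult_1_right)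
qed

text \<open>A root in the open disc would give a quotient equal to -1, whose modulus is too large.
  For a root outside, the reflected point \<open>w\<close> lies in the disc, and the root equation
  makes \<open>conj_reciprocal p\<close> larger in modulus than \<open>p\<close> at
  \<open>w\<close>.\<close>

lemma self_reciprocal_roots:
  assumes nz: "\<And>z. norm z \<le> 1 \<Longrightarrow> poly p z \<noteq> 0" and m: "m > 0"
    and root: "poly (self_reciprocal m p) z = 0"
  shows "norm z = 1"
proof (rule ccontr)
  let ?r = "conj_reciprocal p"
  assume "norm z \<noteq> 1"
  then consider "norm z < 1" | "norm z > 1" by linarith
  then show False
  proof cases
    case 1
    have "poly p z \<noteq> 0" using nz 1 by auto
    then have "z ^ m * (poly ?r z / poly p z) = -1"
      using root by (simp add: self_reciprocal_def poly_monom field_simps eq_neg_iff_add_eq_0)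
    then show False using norm_power_mult_reciprocal_le[OF nz m 1] 1 by simp
  next
    case 2
    define w where "w = cnj (inverse z)"
    have z0: "z \<noteq> 0" using 2 by auto
    have w: "norm w < 1" "w \<noteq> 0" using 2 by (auto simp: w_def norm_inverse inverse_less_1_iff)
    have rz: "poly ?r z = z ^ degree p * cnj (poly p w)"
      using z0 by (simp add: poly_conj_reciprocal w_def)
    have "cnj (poly ?r w) = inverse z ^ degree p * poly p z"
      using w by (simp add: poly_conj_reciprocal) (simp add: w_def)
    then have pz: "poly p z = z ^ degree p * cnj (poly ?r w)"
      using z0 by (simp add: field_simps)
    have "z ^ degree p * (cnj (poly ?r w) + z ^ m * cnj (poly p w)) = 0"
      using root by (simp add: self_reciprocal_def poly_monom rz pz algebra_simps)
    then have "cnj (poly ?r w) = - (z ^ m * cnj (poly p w))"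
      using z0 by (simp add: eq_neg_iff_add_eq_0)
    then have "norm (poly ?r w) = norm z ^ m * norm (poly p w)"
      by (metis complex_mod_cnj norm_minus_cancel norm_mult norm_power)
    moreover have "norm (poly ?r w) \<le> norm (poly p w)"
      using conj_reciprocal_le[OF nz, of w] nz[of w] w by (simp add: norm_divide divide_le_eq)
    moreover have "norm z ^ m > 1" using 2 m by (simp add: one_less_power)
    moreover have "norm (poly p w) > 0" using nz[of w] w by simp
    ultimately show False
      using mult_strict_right_mono[of 1 "norm z ^ m" "norm (poly p w)"] by linarith
  qed
qed

section \<open>Logarithmic derivatives as simple partial fractions\<close>

text \<open>The logarithmic derivative of the factorization into linear factors is a sum of simple
  fractions; multiple roots appear as repeated poles, so their number is
  \<open>degree q\<close>.\<close>

lemma logderiv_in_SF: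
  fixes q :: "complex poly"
  assumes roots: "\<And>z. poly q z = 0 \<Longrightarrow> norm z = 1"
  obtains h where "h \<in> SF (degree q)"
    "\<And>z. poly q z \<noteq> 0 \<Longrightarrow> h z = poly (pderiv q) z / poly q z"
proof -
  obtain xs where q: "smult (lead_coeff q) (\<Prod>i<degree q. [:- xs i, 1:]) = q"
    using complex_poly_decompose'[of q] by metis
  let ?N = "degree q" and ?c = "lead_coeff q"
  define h where "h = (\<lambda>z. \<Sum>j<?N. 1 / (z - xs j))"
  have pq: "poly q z = ?c * (\<Prod>i<?N. z - xs i)" for z
    by (subst q[symmetric]) (simp add: poly_prod)
  have "xs j \<in> sphere 0 1" if "j < ?N" for j
  proof -
    have "poly q (xs j) = 0" unfolding pq using that by (auto intro!: bexI[of _ j])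
    with roots show ?thesis by simp
  qed
  then have "h \<in> SF ?N" unfolding SF_def h_def by blast
  moreover have "h z = poly (pderiv q) z / poly q z" if z: "poly q z \<noteq> 0" for z
  proof -
    have zj: "z - xs j \<noteq> 0" if "j < ?N" for j
      using z that unfolding pq by auto
    have "poly (pderiv q) z = ?c * (\<Sum>j<?N. \<Prod>i\<in>{..<?N} - {j}. z - xs i)"
      by (subst q[symmetric]) (simp add: pderiv_smult pderiv_prod poly_sum poly_prod pderiv_pCons)
    also have "\<dots> = ?c * (\<Sum>j<?N. (\<Prod>i<?N. z - xs i) * (1 / (z - xs j)))"
    proof -
      have "(\<Prod>i\<in>{..<?N} - {j}. z - xs i) = (\<Prod>i<?N. z - xs i) * (1 / (z - xs j))"
        if "j < ?N" for j
        using zj[OF that] that by (subst (2) prod.remove[of _ j]) auto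
      then show ?thesis by simp
    qed
    also have "\<dots> = poly q z * h z"
      by (simp add: pq h_def sum_distrib_left mult.assoc)
    finally show ?thesis using z by simp
  qed
  ultimately show thesis by (rule that)
qed

section \<open>Approximation by logarithmic derivatives of zero-free polynomials\<close>

text \<open>Convergence at the intermediate point \<open>(r + R) / 2\<close> makes the radius of
  convergence exceed \<open>r\<close>, and a power series converges uniformly on smaller closed
  discs.\<close>

lemma uniform_limit_Taylor_cball:
  assumes holf: "f holomorphic_on ball 0 R" and r: "0 \<le> r" "r < R"
  shows "uniform_limit (cball 0 r) (\<lambda>n z. \<Sum>i<n. (deriv ^^ i) f 0 / fact i * z ^ i) f sequentially"
proof -
  let ?a = "\<lambda>i. (deriv ^^ i) f 0 / fact i"
  have s: "(\<lambda>i. ?a i * z ^ i) sums f z" if "norm z < R" for z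
    using holomorphic_power_series[OF holf, of z] that by simp
  have "(\<lambda>i. ?a i * of_real ((r + R) / 2) ^ i) sums f (of_real ((r + R) / 2))"
    by (rule s) (use r in \<open>simp only: norm_of_real, simp\<close>)
  then have "ereal (norm (complex_of_real ((r + R) / 2))) \<le> conv_radius ?a"
    by (intro conv_radius_geI sums_summable)
  moreover have "ereal r < ereal (norm (complex_of_real ((r + R) / 2)))"
    using r by (simp only: norm_of_real less_ereal.simps) simp
  ultimately have "ereal r < conv_radius ?a" by order
  from powser_uniform_limit[OF this, of 0]
  have "uniform_limit (cball 0 r) (\<lambda>n z. \<Sum>i<n. ?a i * z ^ i) (\<lambda>z. \<Sum>i. ?a i * z ^ i) sequentially"
    by simp
  then show ?thesis
    by (rule uniform_limit_cong'[THEN iffD1, rotated -1]) (use s r in \<open>auto simp: sums_iff\<close>)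
qed

lemma pderiv_sum: "pderiv (\<Sum>i\<in>A. f i) = (\<Sum>i\<in>A. pderiv (f i))"
  by (induction A rule: infinite_finite_induct) (simp_all add: pderiv_add)

text \<open>The function \<open>G = exp F\<close>, with \<open>F\<close> a primitive of
  \<open>f\<close>, has no zeros and logarithmic derivative \<open>f\<close>. As
  \<open>R > 1\<close>, its Taylor polynomials and their derivatives converge uniformly on the
  closed unit disc.\<close>

lemma zero_free_logderiv_approx:
  assumes holf: "f holomorphic_on ball 0 R" and R: "R > 1" and \<delta>: "\<delta> > 0"
  obtains p where "\<And>z. norm z \<le> 1 \<Longrightarrow> poly p z \<noteq> 0"
    "\<And>z. norm z \<le> 1 \<Longrightarrow> norm (poly (pderiv p) z / poly p z - f z) \<le> \<delta>"
proof -
  obtain F where F: "\<And>z. z \<in> ball 0 R \<Longrightarrow> (F has_field_derivative f z) (at z)"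
    using holomorphic_convex_primitive'[OF convex_ball open_ball holf]
    by (metis at_within_open open_ball)
  define G where "G = (\<lambda>z. exp (F z))"
  have dG: "(G has_field_derivative f z * G z) (at z)" if "z \<in> ball 0 R" for z
    unfolding G_def by (rule derivative_eq_intros F that refl)+ simp
  then have holG: "G holomorphic_on ball 0 R"
    using holomorphic_on_open open_ball by blast
  have holG': "deriv G holomorphic_on ball 0 R" by (intro holomorphic_deriv holG) auto
  define a where "a = (\<lambda>i. (deriv ^^ i) G 0 / fact i)"
  define p where "p = (\<lambda>n. \<Sum>i<n. monom (a i) i)"
  have p: "poly (p n) = (\<lambda>z. \<Sum>i<n. a i * z ^ i)" for n
    by (simp add: fun_eq_iff p_def poly_sum poly_monom)
  \<comment> \<open>Differentiation shifts the coefficients by one: \<open>Suc n\<close> terms for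
    \<open>G\<close> become \<open>n\<close> terms for \<open>deriv G\<close>, hence the index
    \<open>Suc n\<close> from here on.\<close>
  have a_Suc: "of_nat (Suc i) * a (Suc i) = (deriv ^^ i) (deriv G) 0 / fact i" for i
    by (simp add: a_def funpow_Suc_right del: funpow.simps of_nat_Suc)
  have p': "poly (pderiv (p (Suc n))) = (\<lambda>z. \<Sum>i<n. (deriv ^^ i) (deriv G) 0 / fact i * z ^ i)" for n
    unfolding p_def sum.lessThan_Suc_shift
    by (simp add: fun_eq_iff pderiv_add pderiv_sum pderiv_monom poly_sum poly_monom a_Suc del: of_nat_Suc)
  have sub: "cball 0 1 \<subseteq> ball (0::complex) R" using R by auto
  have lim: "uniform_limit (cball 0 1) (\<lambda>n. poly (p (Suc n))) G sequentially"
    using filterlim_compose[OF uniform_limit_Taylor_cball[OF holG, of 1] filterlim_Suc] R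
    by (simp add: p a_def del: sum.lessThan_Suc)
  have lim': "uniform_limit (cball 0 1) (\<lambda>n. poly (pderiv (p (Suc n)))) (deriv G) sequentially"
    using uniform_limit_Taylor_cball[OF holG', of 1] R by (simp add: p')
  have "continuous_on (cball 0 1) (\<lambda>z. norm (G z))"
    by (intro continuous_on_norm holomorphic_on_imp_continuous_on holomorphic_on_subset[OF holG] sub)
  \<comment> \<open>The positive minimum of the modulus of \<open>G\<close> serves twice: it permits
    the division of uniform limits, and an error below it keeps the Taylor polynomial
    zero-free.\<close>
  then obtain z0 where z0: "\<And>z. z \<in> cball 0 1 \<Longrightarrow> norm (G z0) \<le> norm (G z)"
    using continuous_attains_inf[of "cball (0::complex) 1" "\<lambda>z. norm (G z)"] by fastforce
  have G0: "norm (G z0) > 0" by (simp add: G_def)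
  have bd: "bounded (deriv G ` cball 0 1)"
    by (intro compact_imp_bounded compact_continuous_image holomorphic_on_imp_continuous_on
          holomorphic_on_subset[OF holG'] sub) auto
  have "uniform_limit (cball 0 1) (\<lambda>n z. poly (pderiv (p (Suc n))) z / poly (p (Suc n)) z)
          (\<lambda>z. deriv G z / G z) sequentially"
    by (rule uniform_lim_divide[OF lim' lim bd z0 G0])
  from uniform_limitD[OF this \<delta>] uniform_limitD[OF lim G0]
  have "\<forall>\<^sub>F n in sequentially.
      (\<forall>z\<in>cball 0 1. dist (poly (pderiv (p (Suc n))) z / poly (p (Suc n)) z) (deriv G z / G z) < \<delta>) \<and>
      (\<forall>z\<in>cball 0 1. dist (poly (p (Suc n)) z) (G z) < norm (G z0))"
    by (rule eventually_conj)
  then obtain n where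
      n: "\<And>z. norm z \<le> 1 \<Longrightarrow> dist (poly (pderiv (p (Suc n))) z / poly (p (Suc n)) z) (deriv G z / G z) < \<delta>"
         "\<And>z. norm z \<le> 1 \<Longrightarrow> dist (poly (p (Suc n)) z) (G z) < norm (G z0)"
    using eventually_happens'[OF sequentially_bot] by (metis (lifting) mem_cball_0)
  show thesis
  proof (rule that)
    fix z :: complex assume z: "norm z \<le> 1"
    show "poly (p (Suc n)) z \<noteq> 0"
      using n(2)[OF z] z0[of z] z by auto
    have "deriv G z / G z = f z"
      using dG[of z] z sub by (subst DERIV_imp_deriv[OF dG]) (auto simp: G_def)
    then show "norm (poly (pderiv (p (Suc n))) z / poly (p (Suc n)) z - f z) \<le> \<delta>"
      using n(1)[OF z] by (simp add: dist_norm)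
  qed
qed

section \<open>The self-map \<open>B\<close> attached to a zero-free polynomial\<close>

definition reciprocal_quotient :: "nat \<Rightarrow> complex poly \<Rightarrow> complex \<Rightarrow> complex" where
  "reciprocal_quotient m p z = z ^ m * (poly (conj_reciprocal p) z / poly p z)"

context
  fixes p :: "complex poly"
  assumes nz: "\<And>z. norm z \<le> 1 \<Longrightarrow> poly p z \<noteq> 0"
begin

lemma reciprocal_quotient_holomorphic: "reciprocal_quotient m p holomorphic_on ball 0 1"
  unfolding reciprocal_quotient_def by (intro holomorphic_intros) (use nz in auto)

lemma reciprocal_quotient_le:
  "m > 0 \<Longrightarrow> norm z < 1 \<Longrightarrow> norm (reciprocal_quotient m p z) \<le> norm z"
  unfolding reciprocal_quotient_def by (rule norm_power_mult_reciprocal_le[OF nz])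

text \<open>In the disc \<open>self_reciprocal m p\<close> factors as \<open>p\<close> times
  \<open>1 + B\<close>, and logarithmic derivatives of products add.\<close>

lemma logderiv_self_reciprocal:
  assumes m: "m > 0" and z: "norm z < 1"
  shows "poly (self_reciprocal m p) z \<noteq> 0"
    and "poly (pderiv (self_reciprocal m p)) z / poly (self_reciprocal m p) z
       = poly (pderiv p) z / poly p z
         + deriv (reciprocal_quotient m p) z / (1 + reciprocal_quotient m p z)"
proof -
  let ?q = "self_reciprocal m p" and ?B = "reciprocal_quotient m p"
  show q0: "poly ?q z \<noteq> 0" using self_reciprocal_roots[OF nz m, of z] z by auto
  have q: "poly ?q w = poly p w * (1 + ?B w)" if "norm w < 1" for w
    using nz[of w] that
    by (simp add: self_reciprocal_def reciprocal_quotient_def poly_monom field_simps)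
  have dB: "(?B has_field_derivative deriv ?B z) (at z)"
    using reciprocal_quotient_holomorphic z by (auto intro: holomorphic_derivI[where S = "ball 0 1"])
  have "((\<lambda>w. poly p w * (1 + ?B w)) has_field_derivative
          (poly (pderiv p) z * (1 + ?B z) + poly p z * deriv ?B z)) (at z)"
    by (rule derivative_eq_intros dB refl)+ (simp add: algebra_simps)
  then have "(poly ?q has_field_derivative
          (poly (pderiv p) z * (1 + ?B z) + poly p z * deriv ?B z)) (at z)"
    by (rule has_field_derivative_transform_within_open[where S = "ball 0 1"]) (use q z in auto)
  then have "poly (pderiv ?q) z = poly (pderiv p) z * (1 + ?B z) + poly p z * deriv ?B z"
    using poly_DERIV DERIV_unique by blast
  then show "poly (pderiv ?q) z / poly ?q z = poly (pderiv p) z / poly p z + deriv ?B z / (1 + ?B z)"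
    using q0 z q[OF z] nz[of z] by (simp add: add_divide_distrib)
qed

lemma logderiv_reciprocal_quotient_bound:
  assumes "m > 0" "norm z < 1"
  shows "norm (deriv (reciprocal_quotient m p) z / (1 + reciprocal_quotient m p z))
           \<le> 1 / (1 - norm z)"
  using assms reciprocal_quotient_le[OF assms(1)]
  by (intro self_map_logderiv_bound reciprocal_quotient_holomorphic) force+

text \<open>With \<open>g\<close> the quotient without the power of \<open>z\<close>, the product
  rule bounds the numerator by terms of order \<open>m * \<rho> ^ m\<close>, while the denominator
  stays at least \<open>1 - \<rho>\<close>.\<close>

lemma logderiv_reciprocal_quotient_small:
  assumes \<rho>: "0 < \<rho>" "\<rho> < 1" and \<epsilon>: "\<epsilon> > 0"
  shows "\<forall>\<^sub>F m in sequentially. \<forall>z. norm z \<le> \<rho> \<longrightarrow>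
           norm (deriv (reciprocal_quotient m p) z / (1 + reciprocal_quotient m p z)) \<le> \<epsilon>"
proof -
  define g where "g = (\<lambda>z. poly (conj_reciprocal p) z / poly p z)"
  have holg: "g holomorphic_on ball 0 1"
    unfolding g_def by (intro holomorphic_intros) (use nz in auto)
  have "bounded (deriv g ` cball 0 \<rho>)"
    by (intro compact_imp_bounded compact_continuous_image holomorphic_on_imp_continuous_on
          holomorphic_on_subset[OF holomorphic_deriv[OF holg]]) (use \<rho> in auto)
  then obtain M where M: "M > 0" "\<And>z. norm z \<le> \<rho> \<Longrightarrow> norm (deriv g z) \<le> M"
    by (auto simp: bounded_pos)
  \<comment> \<open>Writing \<open>\<rho> ^ m / \<rho>\<close> for \<open>\<rho> ^ (m - 1)\<close>
    fits the known limit of \<open>m * \<rho> ^ m\<close>; the two agree for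
    \<open>m > 0\<close>.\<close>
  let ?b = "\<lambda>m. (real m * \<rho> ^ m / \<rho> + \<rho> ^ m * M) / (1 - \<rho>)"
  have "?b \<longlonglongrightarrow> (0 / \<rho> + 0 * M) / (1 - \<rho>)"
    by (intro tendsto_intros powser_times_n_limit_0 LIMSEQ_realpow_zero) (use \<rho> in auto)
  then have "\<forall>\<^sub>F m in sequentially. ?b m < \<epsilon>"
    using \<epsilon> by (intro order_tendstoD) auto
  moreover have "\<forall>\<^sub>F m::nat in sequentially. m > 0" by (rule eventually_gt_at_top)
  ultimately show ?thesis
  proof eventually_elim
    case (elim m)
    show ?case
    proof (intro allI impI)
      fix z :: complex assume z: "norm z \<le> \<rho>"
      let ?B = "reciprocal_quotient m p"
      have z1: "norm z < 1" using z \<rho> by simp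
      have dg: "(g has_field_derivative deriv g z) (at z)"
        using holg z1 by (auto intro: holomorphic_derivI[where S = "ball 0 1"])
      have B: "?B = (\<lambda>w. w ^ m * g w)" by (auto simp: reciprocal_quotient_def g_def)
      have "(?B has_field_derivative (of_nat m * z ^ (m - 1) * g z + z ^ m * deriv g z)) (at z)"
        unfolding B by (rule derivative_eq_intros dg refl)+ simp
      then have dB: "deriv ?B z = of_nat m * z ^ (m - 1) * g z + z ^ m * deriv g z"
        by (rule DERIV_imp_deriv)
      have g1: "norm (g z) \<le> 1"
        using conj_reciprocal_le[OF nz, of z] z1 by (simp add: g_def)
      have "norm (deriv ?B z) \<le> real m * norm z ^ (m - 1) * norm (g z) + norm z ^ m * norm (deriv g z)"
        unfolding dB by (rule norm_triangle_le) (simp add: norm_mult norm_power)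
      also have "\<dots> \<le> real m * \<rho> ^ (m - 1) * 1 + \<rho> ^ m * M"
        using z \<rho> M g1 by (intro add_mono mult_mono power_mono) auto
      also have "\<dots> = real m * \<rho> ^ m / \<rho> + \<rho> ^ m * M"
        using elim \<rho> by (simp add: power_eq_if)
      finally have num: "norm (deriv ?B z) \<le> real m * \<rho> ^ m / \<rho> + \<rho> ^ m * M" .
      have "norm (?B z) \<le> \<rho>" using reciprocal_quotient_le[of m z] elim z z1 by simp
      then have "1 - \<rho> \<le> norm (1 + ?B z)"
        using norm_diff_ineq[of 1 "?B z"] by simp
      with num have "norm (deriv ?B z / (1 + ?B z)) \<le> ?b m"
        unfolding norm_divide using \<rho> M by (intro frac_le) auto
      then show "norm (deriv ?B z / (1 + ?B z)) \<le> \<epsilon>" using elim by simp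
    qed
  qed
qed

end

section \<open>Bounded analytic functions and the final assembly\<close>

lemma norm_le_H_infinity_norm:
  assumes "f \<in> H_infinity" "norm z < 1"
  shows "norm (f z) \<le> H_infinity_norm f"
proof -
  have "bdd_above (insert 0 ((\<lambda>z. norm (f z)) ` ball 0 1))"
    using assms by (auto simp: H_infinity_def bounded_iff intro: bdd_aboveI2)
  then show ?thesis unfolding sup_norm_on_def using assms by (intro cSup_upper) auto
qed

lemma H_infinity_norm_nonneg: "f \<in> H_infinity \<Longrightarrow> H_infinity_norm f \<ge> 0"
  using norm_le_H_infinity_norm[of f 0] norm_ge_zero[of "f 0"] by (simp del: norm_ge_zero)

text \<open>The dilation \<open>fr\<close> is holomorphic on a disc of radius
  \<open>1 / r > 1\<close>, so it can be approximated on the closed unit disc. It is bounded by the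
  norm of \<open>f\<close>, and uniform continuity makes it close to \<open>f\<close> on the disc of
  radius \<open>\<rho>\<close>.\<close>

lemma zero_free_logderiv_approx_H_infinity:
  assumes f: "f \<in> H_infinity" and \<rho>: "0 < \<rho>" "\<rho> < 1" and \<epsilon>: "\<epsilon> > 0"
  obtains p where "\<And>z. norm z \<le> 1 \<Longrightarrow> poly p z \<noteq> 0"
    "\<And>z. norm z \<le> \<rho> \<Longrightarrow> norm (poly (pderiv p) z / poly p z - f z) \<le> \<epsilon>"
    "\<And>z. norm z < 1 \<Longrightarrow> norm (poly (pderiv p) z / poly p z) \<le> 2 * H_infinity_norm f"
proof (cases "H_infinity_norm f = 0")
  case True
  then have "f z = 0" if "norm z < 1" for z
    using norm_le_H_infinity_norm[OF f that] by simp
  \<comment> \<open>If the norm is 0, it cannot serve as a positive tolerance; then \<open>f\<close>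
    vanishes in the disc and the constant polynomial 1 suffices.\<close>
  then show thesis using True \<rho> \<epsilon> by (intro that[of 1]) auto
next
  case False
  let ?M = "H_infinity_norm f"
  have M: "?M > 0"
    using H_infinity_norm_nonneg[OF f] False by simp
  have holf: "f holomorphic_on ball 0 1" using f by (simp add: H_infinity_def)
  then have "continuous_on (cball 0 \<rho>) f"
    by (intro holomorphic_on_imp_continuous_on holomorphic_on_subset[OF holf]) (use \<rho> in auto)
  then have "uniformly_continuous_on (cball 0 \<rho>) f"
    by (rule compact_uniformly_continuous) auto
  then obtain d where d: "d > 0"
    "\<And>z w. \<lbrakk>norm z \<le> \<rho>; norm w \<le> \<rho>; dist w z < d\<rbrakk> \<Longrightarrow> dist (f w) (f z) < \<epsilon> / 2"
    unfolding uniformly_continuous_on_def using \<epsilon> by (metis half_gt_zero mem_cball_0)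
  \<comment> \<open>The second entry gives \<open>1 - r < d\<close>, the first keeps
    \<open>r\<close> positive.\<close>
  define r where "r = max (1 / 2) (1 - d / 2)"
  have r: "0 < r" "r < 1" "1 - r < d" using d(1) by (auto simp: r_def)
  define fr where "fr = (\<lambda>z. f (of_real r * z))"
  have rz: "norm (of_real r * z) < 1" if "norm z < 1 / r" for z :: complex
    using that r by (simp add: norm_mult field_simps)
  have "(f \<circ> (\<lambda>z. of_real r * z)) holomorphic_on ball 0 (1 / r)"
    by (intro holomorphic_on_compose_gen[OF _ holf] holomorphic_intros) (use rz in auto)
  then have holfr: "fr holomorphic_on ball 0 (1 / r)" by (simp add: fr_def o_def)
  \<comment> \<open>The tolerance \<open>\<epsilon> / 2\<close> serves the approximation of
    \<open>f\<close>; the tolerance \<open>?M\<close> gives the bound \<open>2 * ?M\<close>.\<close>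
  obtain p where p: "\<And>z. norm z \<le> 1 \<Longrightarrow> poly p z \<noteq> 0"
    "\<And>z. norm z \<le> 1 \<Longrightarrow> norm (poly (pderiv p) z / poly p z - fr z) \<le> min (\<epsilon> / 2) ?M"
    using zero_free_logderiv_approx[OF holfr, of "min (\<epsilon> / 2) ?M"] r M \<epsilon> by auto
  show thesis
  proof (rule that[OF p(1)])
    fix z :: complex assume z: "norm z \<le> \<rho>"
    have "dist (of_real r * z) z = (1 - r) * norm z"
    proof -
      have "of_real r * z - z = of_real (r - 1) * z" by (simp add: algebra_simps)
      then show ?thesis using r by (simp only: dist_norm norm_mult norm_of_real) simp
    qed
    also have "\<dots> \<le> (1 - r) * 1" using r z \<rho> by (intro mult_left_mono) auto
    finally have "dist (of_real r * z) z < d" using r by simp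
    moreover have "norm (of_real r * z) \<le> \<rho>"
      using mult_mono[of r 1 "norm z" \<rho>] r z by (simp add: norm_mult)
    ultimately have "norm (fr z - f z) < \<epsilon> / 2" using d(2) z by (simp add: fr_def dist_norm)
    moreover have "norm (poly (pderiv p) z / poly p z - fr z) \<le> \<epsilon> / 2" using p(2)[of z] z \<rho> by simp
    ultimately show "norm (poly (pderiv p) z / poly p z - f z) \<le> \<epsilon>"
      using norm_triangle_ineq[of "poly (pderiv p) z / poly p z - fr z" "fr z - f z"] by simp
  next
    fix z :: complex assume z: "norm z < 1"
    have "norm z < 1 / r" using z r by (smt (verit) less_divide_eq_1_pos)
    then have "norm (fr z) \<le> ?M" unfolding fr_def by (intro norm_le_H_infinity_norm f rz)
    moreover have "norm (poly (pderiv p) z / poly p z - fr z) \<le> ?M" using p(2)[of z] z by simp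
    ultimately show "norm (poly (pderiv p) z / poly p z) \<le> 2 * ?M"
      using norm_triangle_ineq[of "poly (pderiv p) z / poly p z - fr z" "fr z"] by simp
  qed auto
qed

theorem theorem9:
  shows "\<exists>C0 :: real. \<forall>f \<in> H_infinity. \<forall>\<epsilon> > 0. \<forall>K. compact K \<and> K \<subseteq> ball 0 1 \<longrightarrow>
    (\<exists>N0 \<ge> 1. \<forall>N \<ge> N0. \<exists>h \<in> SF N.
       sup_norm_on K (\<lambda>z. f z - h z) \<le> \<epsilon> \<and>
       (\<forall>z \<in> ball 0 1. norm (h z) \<le>
          1 / (1 - norm z) + C0 * H_infinity_norm f * ln (exp 1 / (1 - norm z))))"
\<comment> \<open>The constant 2 comes from the bound \<open>2 * ?M\<close> on the logarithmic
  derivative of \<open>p\<close>; the logarithm in the claim is at least 1.\<close>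
proof (rule exI[of _ 2], intro ballI allI impI, elim conjE)
  fix f :: "complex \<Rightarrow> complex" and \<epsilon> :: real and K :: "complex set"
  assume f: "f \<in> H_infinity" and \<epsilon>: "\<epsilon> > 0" and K: "compact K" "K \<subseteq> ball 0 1"
  let ?M = "H_infinity_norm f"
  have M: "?M \<ge> 0" by (rule H_infinity_norm_nonneg[OF f])
  obtain \<rho> where \<rho>: "0 < \<rho>" "\<rho> < 1" "\<And>z. z \<in> K \<Longrightarrow> norm z \<le> \<rho>"
  proof (cases "K = {}")
    case True
    then show thesis using that[of "1 / 2"] by simp
  next
    case False
    obtain w where w: "w \<in> K" "\<And>z. z \<in> K \<Longrightarrow> norm z \<le> norm w"
      using continuous_attains_sup[OF K(1) False, of norm] by (auto intro: continuous_intros)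
    then show thesis using that[of "max (1 / 2) (norm w)"] K(2) by (force simp: le_max_iff_disj)
  qed
  obtain p where p: "\<And>z. norm z \<le> 1 \<Longrightarrow> poly p z \<noteq> 0"
    "\<And>z. norm z \<le> \<rho> \<Longrightarrow> norm (poly (pderiv p) z / poly p z - f z) \<le> \<epsilon> / 2"
    "\<And>z. norm z < 1 \<Longrightarrow> norm (poly (pderiv p) z / poly p z) \<le> 2 * ?M"
    using zero_free_logderiv_approx_H_infinity[OF f \<rho>(1,2), of "\<epsilon> / 2"] \<epsilon> by auto
  let ?L = "\<lambda>m z. deriv (reciprocal_quotient m p) z / (1 + reciprocal_quotient m p z)"
  obtain m0 where m0: "\<And>m z. m \<ge> m0 \<Longrightarrow> norm z \<le> \<rho> \<Longrightarrow> norm (?L m z) \<le> \<epsilon> / 2"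
    using logderiv_reciprocal_quotient_small[OF p(1) \<rho>(1,2), of "\<epsilon> / 2"] \<epsilon>
    by (auto simp: eventually_sequentially)
  show "\<exists>N0\<ge>1. \<forall>N\<ge>N0. \<exists>h\<in>SF N. sup_norm_on K (\<lambda>z. f z - h z) \<le> \<epsilon> \<and>
      (\<forall>z\<in>ball 0 1. norm (h z) \<le> 1 / (1 - norm z) + 2 * ?M * ln (exp 1 / (1 - norm z)))"
  \<comment> \<open>The exponent will be \<open>m = N - degree p\<close>, so that
    \<open>self_reciprocal m p\<close> has degree \<open>N\<close>; this threshold ensures both
    \<open>m \<ge> m0\<close> and \<open>m > 0\<close>.\<close>
  proof (intro exI[of _ "degree p + m0 + 1"] conjI allI impI)
    fix N assume N: "N \<ge> degree p + m0 + 1"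
    define m where "m = N - degree p"
    have m: "m > 0" "m \<ge> m0" "m + degree p = N" using N by (auto simp: m_def)
    have deg: "degree (self_reciprocal m p) = N"
      using degree_self_reciprocal[OF p(1) m(1)] m(3) by simp
    obtain h where h: "h \<in> SF N"
      "\<And>z. poly (self_reciprocal m p) z \<noteq> 0 \<Longrightarrow>
         h z = poly (pderiv (self_reciprocal m p)) z / poly (self_reciprocal m p) z"
      using logderiv_in_SF[of "self_reciprocal m p"] self_reciprocal_roots[OF p(1) m(1)]
      unfolding deg by blast
    have hz: "h z = poly (pderiv p) z / poly p z + ?L m z" if "norm z < 1" for z
      using h(2)[OF logderiv_self_reciprocal(1)[OF p(1) m(1) that]]
        logderiv_self_reciprocal(2)[OF p(1) m(1) that] by simp
    have "norm (f z - h z) \<le> \<epsilon>" if "z \<in> K" for z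
    proof -
      have z: "norm z \<le> \<rho>" "norm z < 1" using \<rho> that K(2) by auto
      have "f z - h z = - ((poly (pderiv p) z / poly p z - f z) + ?L m z)"
        using hz[OF z(2)] by simp
      also have "norm \<dots> \<le> \<epsilon> / 2 + \<epsilon> / 2"
        unfolding norm_minus_cancel by (intro norm_triangle_mono p(2) m0 z m)
      finally show ?thesis by simp
    qed
    \<comment> \<open>The inserted value 0 is also below \<open>\<epsilon>\<close>, which covers an
      empty \<open>K\<close>.\<close>
    then have "sup_norm_on K (\<lambda>z. f z - h z) \<le> \<epsilon>"
      unfolding sup_norm_on_def using \<epsilon> by (intro cSup_least) auto
    moreover have "norm (h z) \<le> 1 / (1 - norm z) + 2 * ?M * ln (exp 1 / (1 - norm z))"
      if "z \<in> ball 0 1" for z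
    proof -
      have z: "norm z < 1" using that by simp
      have "ln (1 - norm z) \<le> 0" using z by simp
      then have "1 \<le> ln (exp 1 / (1 - norm z))" using z by (simp add: ln_div)
      then have "2 * ?M * 1 \<le> 2 * ?M * ln (exp 1 / (1 - norm z))"
        using M by (intro mult_left_mono) auto
      moreover have "norm (h z) \<le> 2 * ?M + 1 / (1 - norm z)"
        unfolding hz[OF z]
        by (intro norm_triangle_mono p(3) z logderiv_reciprocal_quotient_bound p(1) m)
      ultimately show ?thesis by simp
    qed
    ultimately show "\<exists>h\<in>SF N. sup_norm_on K (\<lambda>z. f z - h z) \<le> \<epsilon> \<and>
      (\<forall>z\<in>ball 0 1. norm (h z) \<le> 1 / (1 - norm z) + 2 * ?M * ln (exp 1 / (1 - norm z)))"
      using h(1) by blast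
  qed simp
qed

end
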